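(* Let $G$ be a finite simple undirected graph that is $\{P_5, \mathrm{Flag}^C\}$-free, i.e. $G$ contains no induced subgraph isomorphic to $P_5$ and no induced subgraph isomorphic to $\mathrm{Flag}^C$. Then $$\chi(G) \leq \left\lceil \frac{\Delta(G) + \omega(G) + 1}{2} \right\rceil .$$
   Context: All graphs are finite, simple and undirected. For a graph $G$, $\chi(G)$ denotes its chromatic number, $\omega(G)$ the size of a maximum clique, and $\Delta(G)$ the maximum degree. For a family $\mathcal{F}$ of graphs, $G$ is $\mathcal{F}$-free if no induced subgraph of $G$ is isomorphic to a member of $\mathcal{F}$. $P_5$ is the path on 5 vertices. $\mathrm{Flag}^C$ (the complement of the graph called Flag) is the graph on 5 vertices $a,b,c,d,e$ with edge set exactly $\{ab, bc, cd, da, ae\}$, i.e. a chordless 4-cycle together with one pendant vertex attached to one vertex of the cycle. (Equivalently, Flag is a triangle with a path of length 2 attached at one of its vertices.) *)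

theory Defs
  imports Complex_Main "HOL-Library.Ramsey"
begin

text \<open>A graph is a pair of a vertex set and a set of edges, each edge being a two-element set of
  vertices (\<open>[V]\<^bsup>2\<^esup>\<close> is the set of two-element subsets of \<open>V\<close>).\<close>

type_synonym 'a ugraph = "'a set \<times> 'a set set"

abbreviation verts :: "'a ugraph \<Rightarrow> 'a set" where
  "verts G \<equiv> fst G"

abbreviation edges :: "'a ugraph \<Rightarrow> 'a set set" where
  "edges G \<equiv> snd G"

definition finite_simple_graph :: "'a ugraph \<Rightarrow> bool" where
  "finite_simple_graph G \<longleftrightarrow> finite (verts G) \<and> edges G \<subseteq> [verts G]\<^bsup>2\<^esup>"

definition adjacent :: "'a ugraph \<Rightarrow> 'a \<Rightarrow> 'a \<Rightarrow> bool" where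
  "adjacent G u v \<longleftrightarrow> {u, v} \<in> edges G"

definition induced_subgraph :: "'a ugraph \<Rightarrow> 'a set \<Rightarrow> 'a ugraph" where
  "induced_subgraph G S = (S, {e \<in> edges G. e \<subseteq> S})"

definition isomorphic :: "'a ugraph \<Rightarrow> 'b ugraph \<Rightarrow> bool" where
  "isomorphic G H \<longleftrightarrow> (\<exists>f. bij_betw f (verts G) (verts H) \<and>
     (\<forall>u\<in>verts G. \<forall>v\<in>verts G. adjacent G u v \<longleftrightarrow> adjacent H (f u) (f v)))"

definition family_free :: "'b ugraph set \<Rightarrow> 'a ugraph \<Rightarrow> bool" where
  "family_free \<F> G \<longleftrightarrow>
     \<not> (\<exists>S \<subseteq> verts G. \<exists>H \<in> \<F>. isomorphic (induced_subgraph G S) H)"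

definition P5 :: "nat ugraph" where
  "P5 = ({0, 1, 2, 3, 4}, {{0, 1}, {1, 2}, {2, 3}, {3, 4}})"

text \<open>The vertices \<open>a, b, c, d, e\<close> of the complement of the Flag are \<open>0, 1, 2, 3, 4\<close>.\<close>

definition Flag_compl :: "nat ugraph" where
  "Flag_compl = ({0, 1, 2, 3, 4}, {{0, 1}, {1, 2}, {2, 3}, {3, 0}, {0, 4}})"

definition proper_coloring :: "'a ugraph \<Rightarrow> nat \<Rightarrow> ('a \<Rightarrow> nat) \<Rightarrow> bool" where
  "proper_coloring G k c \<longleftrightarrow> c ` verts G \<subseteq> {..<k} \<and>
     (\<forall>u\<in>verts G. \<forall>v\<in>verts G. adjacent G u v \<longrightarrow> c u \<noteq> c v)"

definition chromatic_number :: "'a ugraph \<Rightarrow> nat" where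
  "chromatic_number G = (LEAST k. \<exists>c. proper_coloring G k c)"

definition clique_number :: "'a ugraph \<Rightarrow> nat" where
  "clique_number G = Max (card ` {K. K \<subseteq> verts G \<and> clique K (edges G)})"

definition degree :: "'a ugraph \<Rightarrow> 'a \<Rightarrow> nat" where
  "degree G v = card {u \<in> verts G. adjacent G v u}"

text \<open>Inserting \<open>0\<close> only matters for the graph without vertices, whose maximum degree is
  thereby \<open>0\<close>.\<close>

definition max_degree :: "'a ugraph \<Rightarrow> nat" where
  "max_degree G = Max (insert 0 (degree G ` verts G))"

end

theory Submission
  imports Defs
begin

text \<open>A counterexample with fewest vertices has no clique cutset (recolour the two sides) and, by a
  count of degrees and cliques, a connected complement. Then every proper module is a clique: for a
  largest module \<open>M\<close> that is not, \<open>N(M)\<close> is not a clique either, and a nontrivial co-component of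
  \<open>N(M)\<close>, or of the neighbourhood of that one, would yield a larger such module. The common
  neighbourhood of a stable triple is therefore a clique, and from this one obtains that no stable
  triple exists at all.
  With stability number 2 a colouring is a matching of the complement. By minimality every vertex is
  missed by some maximum matching, so Gallai's lemma gives \<open>2 \<chi>(G) \<le> |V| + 1\<close>, while
  \<open>|V| \<le> \<Delta>(G) + \<omega>(G) + 1\<close> because the non-neighbours of a vertex form a clique.\<close>

section \<open>Structure of graphs without clique cutsets\<close>

locale simple_adjacency =
  fixes E :: "'a \<Rightarrow> 'a \<Rightarrow> bool"
  assumes sym: "E x y \<Longrightarrow> E y x" and irrefl: "\<not> E x x"
begin

definition complete :: "'a set \<Rightarrow> bool" where
  "complete K \<longleftrightarrow> (\<forall>x\<in>K. \<forall>y\<in>K. x \<noteq> y \<longrightarrow> E x y)"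

text \<open>Connectedness is stated through cuts instead of paths, so that each use amounts to
  choosing a cut; \<open>coconn\<close> is the same notion for the complement.\<close>

definition conn :: "'a set \<Rightarrow> bool" where
  "conn S \<longleftrightarrow> (\<forall>A\<subseteq>S. A \<noteq> {} \<longrightarrow> A \<noteq> S \<longrightarrow> (\<exists>a\<in>A. \<exists>b\<in>S - A. E a b))"

definition coconn :: "'a set \<Rightarrow> bool" where
  "coconn S \<longleftrightarrow> (\<forall>A\<subseteq>S. A \<noteq> {} \<longrightarrow> A \<noteq> S \<longrightarrow> (\<exists>a\<in>A. \<exists>b\<in>S - A. \<not> E a b))"

text \<open>Since \<open>x\<close> and \<open>y\<close> range over ordered pairs, the one
  implication makes an outside vertex see all of \<open>M\<close> or nothing of it.\<close>

definition module_in :: "'a set \<Rightarrow> 'a set \<Rightarrow> bool" where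
  "module_in V M \<longleftrightarrow> M \<subseteq> V \<and> (\<forall>z\<in>V - M. \<forall>x\<in>M. \<forall>y\<in>M. E z x \<longrightarrow> E z y)"

lemma sym_iff: "E x y \<longleftrightarrow> E y x"
  using sym by blast

lemma connE:
  assumes "conn S" "A \<subseteq> S" "x \<in> A" "y \<in> S" "y \<notin> A"
  obtains a b where "a \<in> A" "b \<in> S" "b \<notin> A" "E a b"
  using assms unfolding conn_def by (metis Diff_iff empty_iff)

lemma coconnE:
  assumes "coconn S" "A \<subseteq> S" "x \<in> A" "y \<in> S" "y \<notin> A"
  obtains a b where "a \<in> A" "b \<in> S" "b \<notin> A" "\<not> E a b"
  using assms unfolding coconn_def by (metis Diff_iff empty_iff)

text \<open>A smallest set that contains \<open>w\<close> and is completely joined to the rest of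
  \<open>W\<close> works: if it split into two completely joined parts, the part with
  \<open>w\<close> would be a smaller such set.\<close>

lemma coconn_component:
  assumes "finite W" "w \<in> W"
  obtains Z where "w \<in> Z" "Z \<subseteq> W" "coconn Z" "\<And>x z. x \<in> W \<Longrightarrow> x \<notin> Z \<Longrightarrow> z \<in> Z \<Longrightarrow> E x z"
proof -
  let ?P = "\<lambda>Z. w \<in> Z \<and> Z \<subseteq> W \<and> (\<forall>x\<in>W - Z. \<forall>z\<in>Z. E x z)"
  have "?P W" using assms by auto
  then obtain Z where Z: "?P Z" and min: "\<And>Y. ?P Y \<Longrightarrow> card Z \<le> card Y"
    using ex_has_least_nat[of ?P W card] by auto
  have fin: "finite Z" using Z assms(1) finite_subset by blast
  have "coconn Z"
    unfolding coconn_def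
  proof (intro allI impI, rule ccontr)
    fix A assume A: "A \<subseteq> Z" "A \<noteq> {}" "A \<noteq> Z" and "\<not> (\<exists>a\<in>A. \<exists>b\<in>Z - A. \<not> E a b)"
    then have full: "\<And>a b. a \<in> A \<Longrightarrow> b \<in> Z - A \<Longrightarrow> E a b \<and> E b a" using sym by blast
    have "card A < card Z" "card (Z - A) < card Z"
      using A fin by (auto intro!: psubset_card_mono)
    moreover have "?P A \<or> ?P (Z - A)"
      using Z A full by blast
    ultimately show False using min[of A] min[of "Z - A"] by linarith
  qed
  then show thesis using that Z by blast
qed

text \<open>Used with \<open>P\<close> the adjacency to an outside vertex: a vertex that
  distinguishes two members of a co-connected set also distinguishes two nonadjacent ones.\<close>

lemma coconn_mixed:
  assumes "coconn Z" "x \<in> Z" "y \<in> Z" "P x" "\<not> P y"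
  obtains u v where "u \<in> Z" "v \<in> Z" "P u" "\<not> P v" "u \<noteq> v" "\<not> E u v"
proof -
  obtain u v where "u \<in> {z \<in> Z. P z}" "v \<in> Z" "v \<notin> {z \<in> Z. P z}" "\<not> E u v"
    using coconnE[OF assms(1), of "{z \<in> Z. P z}" x y] assms by blast
  then show thesis using that by blast
qed

end

text \<open>\<open>banner\<close> is the 4-cycle \<open>a b c d\<close> with \<open>e\<close>
  pendant at \<open>a\<close>. The adjacencies of the path force distinct vertices, whereas
  \<open>b\<close> and \<open>d\<close> have the same adjacencies and must be required to
  differ.\<close>

locale P5_banner_free = simple_adjacency +
  assumes P5: "E a b \<Longrightarrow> E b c \<Longrightarrow> E c d \<Longrightarrow> E d e \<Longrightarrow> \<not> E a c \<Longrightarrow> \<not> E a d \<Longrightarrow> \<not> E a e \<Longrightarrow>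
      \<not> E b d \<Longrightarrow> \<not> E b e \<Longrightarrow> \<not> E c e \<Longrightarrow> False"
    and banner: "E a b \<Longrightarrow> E b c \<Longrightarrow> E c d \<Longrightarrow> E d a \<Longrightarrow> a \<noteq> c \<Longrightarrow> b \<noteq> d \<Longrightarrow> \<not> E a c \<Longrightarrow> \<not> E b d \<Longrightarrow>
      E a e \<Longrightarrow> \<not> E e b \<Longrightarrow> \<not> E e c \<Longrightarrow> \<not> E e d \<Longrightarrow> False"
begin

text \<open>A shortest path has at most three edges: a vertex at distance 4 from \<open>a\<close>
  would complete an induced path on five vertices.\<close>

lemma conn_path:
  assumes conn: "conn B" and a: "a \<in> B" and c: "c \<in> B" and ac: "a \<noteq> c" "\<not> E a c"
  shows "(\<exists>w\<in>B. E a w \<and> E w c) \<or>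
    (\<exists>s\<in>B. \<exists>t\<in>B. E a s \<and> E s t \<and> E t c \<and> \<not> E a t \<and> \<not> E s c)"
proof (rule ccontr)
  assume neg: "\<not> ?thesis"
  \<comment> \<open>Balls of radius 1, 2 and 3 around \<open>a\<close>; an edge leaving the last one
    ends at distance 4.\<close>
  let ?L0 = "{a} \<union> {x \<in> B. E a x}"
  let ?L = "?L0 \<union> {x \<in> B. \<exists>s\<in>B. E a s \<and> E s x}"
  let ?R = "?L \<union> {x \<in> B. \<exists>s\<in>B. \<exists>t\<in>B. E a s \<and> E s t \<and> E t x}"
  have "c \<notin> ?R" using neg ac sym by blast
  then obtain x y where x: "x \<in> ?R" and y: "y \<in> B" "y \<notin> ?R" and xy: "E x y"
    using connE[OF conn, of ?R a c] a c by blast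
  then have xL: "x \<notin> ?L" by blast
  then obtain s t where st: "s \<in> B" "t \<in> B" "E a s" "E s t" "E t x" "x \<in> B"
    using x by blast
  have "\<not> E a x" "\<not> E s x" using xL st by blast+
  moreover have "\<not> E a y" "\<not> E s y" "\<not> E t y" using y st by blast+
  moreover have "\<not> E a t" using xL st by blast
  ultimately show False
    using P5[of a s t x y] st xy by blast
qed

end

section \<open>Modules in a graph without clique cutsets and with connected complement\<close>

locale reduced = P5_banner_free +
  fixes V :: "'a set"
  assumes fin: "finite V"
    and no_cutset: "K \<subseteq> V \<Longrightarrow> complete K \<Longrightarrow> conn (V - K)"
    and co_connected: "coconn V"
begin

text \<open>A vertex \<open>z\<close> that distinguishes nonadjacent \<open>u\<close>,
  \<open>v\<close> in \<open>Z\<close> lies outside \<open>W\<close> and \<open>M\<close>, so it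
  sees neither \<open>m\<close> nor \<open>m'\<close>; then \<open>u m v m'\<close> is an induced
  4-cycle with \<open>z\<close> pendant at \<open>u\<close>.\<close>

lemma coconn_component_of_nbhd_module:
  assumes M: "module_in V M" and m: "m \<in> M" "m' \<in> M" "m \<noteq> m'" "\<not> E m m'"
    and W: "W = {x \<in> V - M. E x m}"
    and Z: "Z \<subseteq> W" "coconn Z" "\<And>x z. x \<in> W \<Longrightarrow> x \<notin> Z \<Longrightarrow> z \<in> Z \<Longrightarrow> E x z"
  shows "module_in V Z"
  unfolding module_in_def
proof (intro conjI ballI impI, goal_cases)
  case 1 then show ?case using Z(1) W by blast
next
  case (2 z x y)
  show ?case
  proof (rule ccontr)
    assume "\<not> E z y"
    then obtain u v where uv: "u \<in> Z" "v \<in> Z" "E z u" "\<not> E z v" "u \<noteq> v" "\<not> E u v"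
      using coconn_mixed[OF Z(2), of x y "E z"] 2 by blast
    have MW: "E p q" if "p \<in> W" "q \<in> M" for p q
      using that W M m(1) unfolding module_in_def by blast
    have "z \<notin> W" using Z(3) 2 uv(2,4) by blast
    moreover have "z \<notin> M" using MW uv(2,4) Z(1) sym by blast
    ultimately have "\<not> E z m" using 2 W by blast
    moreover have "\<not> E z m'"
      using M m(1,2) 2(1) \<open>z \<notin> M\<close> calculation unfolding module_in_def by blast
    moreover have "E u m" "E u m'" "E v m" "E v m'" using MW uv Z(1) m by blast+
    ultimately show False using banner[of u m v m' z] uv m(3,4) by (auto simp: sym_iff)
  qed
qed

lemma module_complete:
  assumes "module_in V M" "M \<noteq> V"
  shows "complete M"
proof (rule ccontr)
  assume "\<not> complete M"
  let ?P = "\<lambda>M. module_in V M \<and> M \<noteq> V \<and> \<not> complete M"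
  have "?P M" using assms \<open>\<not> complete M\<close> by simp
  moreover have "\<forall>M. ?P M \<longrightarrow> card M < Suc (card V)"
    unfolding module_in_def using fin by (auto simp: less_Suc_eq_le intro: card_mono)
  ultimately obtain M where M: "?P M" and max: "\<And>N. ?P N \<Longrightarrow> card N \<le> card M"
    using ex_has_greatest_nat[of ?P M card "Suc (card V)"] by auto
  have grow: False if "?P N" "M \<subset> N" for N
    using max[OF that(1)] psubset_card_mono[OF _ that(2)] that(1) fin
    unfolding module_in_def by (meson finite_subset not_less)
  have MV: "M \<subseteq> V" using M unfolding module_in_def by blast
  obtain m m' where m: "m \<in> M" "m' \<in> M" "m \<noteq> m'" "\<not> E m m'"
    using M unfolding complete_def by blast
  define D where "D = {x \<in> V - M. E x m}"
  have DM: "E p q" if "p \<in> D" "q \<in> M" for p q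
    using that M m(1) unfolding module_in_def D_def by blast
  have AM: "\<not> E p q" if "p \<in> V" "p \<notin> M" "p \<notin> D" "q \<in> M" for p q
    using that M m(1) unfolding module_in_def D_def by blast
  \<comment> \<open>The complement is connected, so some vertex outside \<open>M\<close> misses a
    member of \<open>M\<close> and therefore lies outside \<open>D\<close>.\<close>
  obtain z0 where z0: "z0 \<in> V" "z0 \<notin> M" "z0 \<notin> D"
  proof -
    obtain y where "y \<in> V" "y \<notin> M" using M MV by blast
    then show thesis using coconnE[OF co_connected MV m(1)] that DM sym by metis
  qed
  \<comment> \<open>A clique \<open>D\<close> would separate \<open>M\<close> from
    \<open>z0\<close>.\<close>
  have "\<not> complete D"
  proof
    assume "complete D"
    moreover have "D \<subseteq> V" "D \<inter> M = {}" unfolding D_def by auto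
    ultimately obtain p q where "p \<in> M" "q \<in> V - D" "q \<notin> M" "E p q"
      using connE[OF no_cutset[of D], of M m z0] m(1) z0 MV by blast
    then show False using AM sym by blast
  qed
  then obtain d d' where d: "d \<in> D" "d' \<in> D" "d \<noteq> d'" "\<not> E d d'"
    unfolding complete_def by blast
  have "finite D" using fin unfolding D_def by simp
  then obtain Z where Z: "d \<in> Z" "Z \<subseteq> D" "coconn Z"
      "\<And>x z. x \<in> D \<Longrightarrow> x \<notin> Z \<Longrightarrow> z \<in> Z \<Longrightarrow> E x z"
    using coconn_component d(1) by blast
  have dZ: "d' \<in> Z" using Z(1,4) d sym by blast
  have modZ: "module_in V Z"
    using coconn_component_of_nbhd_module[OF _ m D_def Z(2-4)] M by blast
  define W where "W = {x \<in> V - Z. E x d}"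
  have MW: "M \<subseteq> W" unfolding W_def using DM Z d MV sym D_def by blast
  show False
  proof (cases "\<exists>z. z \<in> V \<and> z \<notin> M \<and> z \<notin> D \<and> E z d")
    case True
    then obtain z where z: "z \<in> V" "z \<notin> M" "z \<notin> D" "E z d" by blast
    then have "z \<in> W" unfolding W_def using Z by blast
    moreover have "finite W" using fin unfolding W_def by simp
    ultimately obtain Y where Y: "z \<in> Y" "Y \<subseteq> W" "coconn Y"
      "\<And>x y. x \<in> W \<Longrightarrow> x \<notin> Y \<Longrightarrow> y \<in> Y \<Longrightarrow> E x y"
      using coconn_component by blast
    have "module_in V Y"
      using coconn_component_of_nbhd_module[OF modZ Z(1) dZ d(3,4) W_def Y(2-4)] .
    \<comment> \<open>\<open>z\<close> sees nothing of \<open>M\<close>, so its co-component in the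
      neighbourhood of \<open>Z\<close> swallows all of \<open>M\<close>.\<close>
    moreover have "M \<subseteq> Y" using Y(1,4) MW AM[OF z(1-3)] sym by blast
    moreover have "Y \<noteq> V" using Y(2) Z(1) d D_def W_def by blast
    ultimately show False using grow[of Y] m z Y(1) unfolding complete_def by blast
  next
    case False
    \<comment> \<open>Here vertices outside \<open>M\<close> and \<open>D\<close> see nothing of
      \<open>M\<close> or \<open>Z\<close>, while those of \<open>D\<close> outside \<open>Z\<close>
      see all of both.\<close>
    have "module_in V (M \<union> Z)"
      unfolding module_in_def
    proof (intro conjI ballI impI, goal_cases)
      case 1 then show ?case using MV Z(2) D_def by blast
    next
      case (2 z x y)
      show ?case
      proof (cases "z \<in> D")
        case True then show ?thesis using 2 DM Z(4) by blast
      next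
        case nD: False
        then have "\<not> E z w" if "w \<in> Z" for w
          using 2 False modZ Z(1) that unfolding module_in_def by blast
        then show ?thesis using 2 nD AM by blast
      qed
    qed
    moreover have "M \<union> Z \<noteq> V" using z0 Z(2) by blast
    moreover have "\<not> complete (M \<union> Z)" using m unfolding complete_def by blast
    moreover have "M \<subset> M \<union> Z" using d(1) Z D_def by blast
    ultimately show False using grow by blast
  qed
qed

section \<open>Stable triples with common neighbours, and non-neighbourhoods\<close>

lemma no_K23:
  assumes V: "t1 \<in> V" "t2 \<in> V" "t3 \<in> V" "u \<in> V" "v \<in> V"
    and T: "t1 \<noteq> t2" "t1 \<noteq> t3" "t2 \<noteq> t3" "\<not> E t1 t2" "\<not> E t1 t3" "\<not> E t2 t3"
    and uv: "u \<noteq> v" "\<not> E u v"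
    and c: "E u t1" "E u t2" "E u t3" "E v t1" "E v t2" "E v t3"
  shows False
proof -
  \<comment> \<open>A co-component of the common neighbourhood of the triple is a module.\<close>
  define W where "W = {x \<in> V. E x t1 \<and> E x t2 \<and> E x t3}"
  have "finite W" "u \<in> W" "v \<in> W" using fin V c unfolding W_def by auto
  then obtain Z where Z: "u \<in> Z" "Z \<subseteq> W" "coconn Z"
      "\<And>x z. x \<in> W \<Longrightarrow> x \<notin> Z \<Longrightarrow> z \<in> Z \<Longrightarrow> E x z"
    using coconn_component by blast
  have "v \<in> Z" using Z(1,4) \<open>v \<in> W\<close> uv sym by blast
  have "module_in V Z"
    unfolding module_in_def
  proof (intro conjI ballI impI, goal_cases)
    case 1 then show ?case using Z(2) W_def by blast
  next
    case (2 z x y)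
    show ?case
    proof (rule ccontr)
      assume "\<not> E z y"
      then obtain p q where pq: "p \<in> Z" "q \<in> Z" "E z p" "\<not> E z q" "p \<noteq> q" "\<not> E p q"
        using coconn_mixed[OF Z(3), of x y "E z"] 2 by blast
      have c: "E p t1" "E p t2" "E p t3" "E q t1" "E q t2" "E q t3"
        using pq Z(2) W_def by auto
      have zt: "z \<noteq> t1" "z \<noteq> t2" "z \<noteq> t3" using c pq sym by blast+
      have c': "E t1 p" "E t2 p" "E t3 p" "E t1 q" "E t2 q" "E t3 q" using c sym by blast+
      have pq': "E p z" "\<not> E q z" "\<not> E q p" using pq sym by blast+
      have zt': "E t z \<longleftrightarrow> E z t" for t by (rule sym_iff)
      have T': "\<not> E t2 t1" "\<not> E t3 t1" "\<not> E t3 t2" using T sym by blast+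
      have "z \<notin> W" using Z(4) pq 2 by blast
      then have "\<not> E z t1 \<or> \<not> E z t2 \<or> \<not> E z t3" using 2 W_def by blast
      \<comment> \<open>If \<open>z\<close> missed two members of the triple, it would be pendant at
        \<open>p\<close> on the 4-cycle formed by them with \<open>p\<close> and \<open>q\<close>.
        So \<open>z\<close> misses exactly one.\<close>
      moreover have "E z t1 \<or> E z t2" "E z t1 \<or> E z t3" "E z t2 \<or> E z t3"
        using banner[of p t1 q t2 z] banner[of p t1 q t3 z] banner[of p t2 q t3 z] c c' pq pq' T by auto
      \<comment> \<open>The missed member is pendant at \<open>q\<close> on the 4-cycle through
        \<open>q\<close>, \<open>z\<close> and the other two.\<close>
      ultimately show False
        using banner[of q t1 z t2 t3] banner[of q t1 z t3 t2] banner[of q t2 z t3 t1] c c' pq pq' zt zt' T T'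
        by auto
    qed
  qed
  moreover have "Z \<noteq> V" using Z(2) W_def V irrefl by blast
  ultimately show False using module_complete Z(1) \<open>v \<in> Z\<close> uv unfolding complete_def by blast
qed

text \<open>The neighbours of \<open>a\<close> with a neighbour in \<open>B1\<close> separate
  \<open>B1\<close> from \<open>a\<close>, so they form no clique. Two nonadjacent ones among them
  see nothing of \<open>B2\<close>, since every other configuration contains a forbidden subgraph or
  contradicts \<open>no_K23\<close>.\<close>

lemma split_nbhd_not_complete:
  assumes a: "a \<in> V" and B: "B1 \<noteq> {}" "B1 \<inter> B2 = {}"
    "B1 \<union> B2 = {x \<in> V. x \<noteq> a \<and> \<not> E a x}"
    and sep: "\<And>x y. x \<in> B1 \<Longrightarrow> y \<in> B2 \<Longrightarrow> \<not> E x y"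
  obtains u v b b' where "u \<in> V" "v \<in> V" "u \<noteq> v" "\<not> E u v" "E a u" "E a v" "b \<in> B1" "E u b"
    "b' \<in> B1" "E v b'" "\<forall>w\<in>B2. \<not> E u w \<and> \<not> E v w"
proof -
  define S where "S = {x \<in> V. E a x \<and> (\<exists>b\<in>B1. E x b)}"
  have B1V: "x \<in> V \<and> x \<noteq> a \<and> \<not> E a x" if "x \<in> B1" for x using B(3) that by blast
  have B2V: "x \<in> V \<and> x \<noteq> a \<and> \<not> E a x" if "x \<in> B2" for x using B(3) that by blast
  obtain b0 where b0: "b0 \<in> B1" using B(1) by blast
  have "\<not> complete S"
  proof
    assume "complete S"
    moreover have "S \<subseteq> V" "B1 \<subseteq> V - S" "a \<in> V - S" "a \<notin> B1"
      using B1V a irrefl unfolding S_def by blast+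
    ultimately obtain p q where pq: "p \<in> B1" "q \<in> V - S" "q \<notin> B1" "E p q"
      using connE[OF no_cutset[of S], of B1 b0 a] b0 by blast
    have "q \<noteq> a" "q \<notin> B2" using pq B1V sep sym by blast+
    then have "E a q" using pq B(3) by blast
    then show False using pq sym S_def by blast
  qed
  then obtain u v where uv: "u \<in> S" "v \<in> S" "u \<noteq> v" "\<not> E u v" unfolding complete_def by blast
  then have uvV: "u \<in> V" "v \<in> V" "E a u" "E a v" unfolding S_def by auto
  have key: "\<not> E p w" if "w \<in> B2" and pq: "p \<in> S" "q \<in> S" "p \<noteq> q" "\<not> E p q" for p q w
  proof
    assume pw: "E p w"
    obtain b where b: "b \<in> B1" "E q b" using pq S_def by blast
    obtain b' where b': "b' \<in> B1" "E p b'" using pq S_def by blast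
    have n: "E a p" "E a q" "p \<in> V" "q \<in> V" using pq S_def by auto
    note nb = B1V[OF b(1)] B1V[OF b'(1)] B2V[OF that(1)] sep[OF b(1) that(1)] sep[OF b'(1) that(1)]
    have "w \<noteq> b" "w \<noteq> b'" using that b b' B(2) by blast+
    note nb = nb this
    show False
    proof (cases "E q w")
      case True
      \<comment> \<open>Otherwise \<open>b'\<close> is pendant at \<open>p\<close> on the cycle
        \<open>p a q w\<close>. Hence the stable triple \<open>a\<close>, \<open>w\<close>,
        \<open>b'\<close> has the nonadjacent common neighbours \<open>p\<close>,
        \<open>q\<close>.\<close>
      have "E q b'" using banner[of p a q w b'] n nb pq pw b' True by (auto simp: sym_iff)
      then show ?thesis
        using no_K23[of a w b' p q] n nb pq pw b' True a by (auto simp: sym_iff)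
    next
      case False
      \<comment> \<open>If \<open>p\<close> sees \<open>b\<close>, then \<open>w\<close> is pendant
        at \<open>p\<close> on the cycle \<open>p a q b\<close>; otherwise \<open>b q a p w\<close>
        is an induced path.\<close>
      show ?thesis
        using banner[of p a q b w] P5[of b q a p w] n nb pq pw b False by (auto simp: sym_iff)
    qed
  qed
  have sep': "\<not> E u w \<and> \<not> E v w" if "w \<in> B2" for w
    using key[OF that uv] key[OF that uv(2,1)] uv sym by blast
  show thesis
  proof -
    obtain b b' where "b \<in> B1" "E u b" "b' \<in> B1" "E v b'" using uv(1,2) S_def by blast
    then show thesis using that[of u v b b'] uv(3,4) uvV sep' by blast
  qed
qed

text \<open>Each side of a separation gives a nonadjacent pair of neighbours of \<open>a\<close>,
  and the two pairs form a 4-cycle \<open>u s v t\<close>. The neighbour \<open>b\<close> of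
  \<open>u\<close> must then see \<open>v\<close>, and \<open>u\<close>, \<open>v\<close> are common
  neighbours of the stable triple \<open>s\<close>, \<open>t\<close>, \<open>b\<close>.\<close>

lemma non_nbhd_conn:
  assumes a: "a \<in> V"
  shows "conn {x \<in> V. x \<noteq> a \<and> \<not> E a x}" (is "conn ?N")
  unfolding conn_def
proof (intro allI impI, rule ccontr)
  fix B1 assume B1: "B1 \<subseteq> ?N" "B1 \<noteq> {}" "B1 \<noteq> ?N" and neg: "\<not> (\<exists>x\<in>B1. \<exists>y\<in>?N - B1. E x y)"
  define B2 where "B2 = ?N - B1"
  have B: "B2 \<noteq> {}" "B1 \<inter> B2 = {}" "B2 \<inter> B1 = {}" "B1 \<union> B2 = ?N" "B2 \<union> B1 = ?N"
    using B1 unfolding B2_def by auto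
  have sep: "\<not> E x y" "\<not> E y x" if "x \<in> B1" "y \<in> B2" for x y
    using neg that sym unfolding B2_def by blast+
  obtain u v b b' where u: "u \<in> V" "v \<in> V" "u \<noteq> v" "\<not> E u v" "E a u" "E a v"
    "b \<in> B1" "E u b" "b' \<in> B1" "E v b'" and u2: "\<forall>w\<in>B2. \<not> E u w \<and> \<not> E v w"
    by (rule split_nbhd_not_complete[OF a B1(2) B(2,4) sep(1)])
  obtain s t d d' where s: "s \<in> V" "t \<in> V" "s \<noteq> t" "\<not> E s t" "E a s" "E a t"
    "d \<in> B2" "E s d" "d' \<in> B2" "E t d'" and s2: "\<forall>w\<in>B1. \<not> E s w \<and> \<not> E t w"
    by (rule split_nbhd_not_complete[OF a B(1,3,5) sep(2)])
  have B1a: "\<not> E a x" "x \<in> V" "x \<noteq> a" if "x \<in> B1" for x using that B(4) by blast+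
  have B2a: "\<not> E a x" if "x \<in> B2" for x using that B(4) by blast
  \<comment> \<open>Otherwise \<open>x p a q y\<close> is an induced path.\<close>
  have cross: "E p q" if "E a p" "E a q" "x \<in> B1" "y \<in> B2" "E p x" "E q y" "\<not> E p y" "\<not> E q x"
    for p q x y
    using P5[of x p a q y] that B1a(1)[of x] B2a[of y] sep(1)[of x y] by (auto simp: sym_iff)
  have nb: "\<not> E u d" "\<not> E u d'" "\<not> E v d" "\<not> E v d'" "\<not> E s b" "\<not> E t b" "\<not> E s b'" "\<not> E t b'"
    using u2 s2 u(7,9) s(7,9) by blast+
  have us: "E u s" "E u t" "E v s" "E v t"
    using cross[of u s b d] cross[of u t b d'] cross[of v s b' d] cross[of v t b' d']
      u s nb by simp_all
  have "E v b"
    using banner[of u s v t b] us u s nb by (auto simp: sym_iff)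
  moreover have "s \<noteq> b" "t \<noteq> b" using u(7) s(5,6) B1a(1) by blast+
  ultimately show False
    using no_K23[of s t b u v] us u s B1a(2)[of b] nb by (auto simp: sym_iff)
qed

section \<open>Vertices with two neighbours in a stable triple\<close>

text \<open>At least two neighbours in the triple: outside this set, no path with two edges joins
  two of its members.\<close>

definition dual_nbhd :: "'a \<Rightarrow> 'a \<Rightarrow> 'a \<Rightarrow> 'a set" where
  "dual_nbhd a b c = {x \<in> V. E x a \<and> E x b \<or> E x a \<and> E x c \<or> E x b \<and> E x c}"

text \<open>Vertices are compared by the members of the triple that they see. The witnesses
  \<open>w\<close> and \<open>w'\<close> guarantee that every class with exactly two neighbours has
  a vertex of another such class to compare with.\<close>

lemma dual_nbhd_complete:
  assumes abc: "a \<in> V" "b \<in> V" "c \<in> V" "a \<noteq> b" "a \<noteq> c" "b \<noteq> c" "\<not> E a b" "\<not> E a c" "\<not> E b c"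
    and w: "w \<in> V" "E w a" "E w b" "\<not> E w c" "w' \<in> V" "E w' a" "E w' c" "\<not> E w' b"
  shows "complete (dual_nbhd a b c)"
proof -
  \<comment> \<open>Otherwise \<open>r\<close> is pendant at \<open>u\<close> on the cycle
    \<open>u p v q\<close>.\<close>
  have triple_pair: "E u v" if "u \<noteq> v" "E u p" "E u q" "E u r" "E v p" "E v q" "\<not> E v r"
    "\<not> E p q" "\<not> E p r" "\<not> E q r" "p \<noteq> q" for u v p q r
    using banner[of u p v q r] that by (auto simp: sym_iff)
  have two_pairs: "E u v" if "E u p" "E u q" "\<not> E u r" "E v p" "E v r" "\<not> E v q"
    "\<not> E p q" "\<not> E p r" "\<not> E q r" for u v p q r
    using P5[of q u p v r] that by (auto simp: sym_iff)
  \<comment> \<open>By \<open>two_pairs\<close>, \<open>x\<close> sees both; if \<open>u\<close>,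
    \<open>v\<close> were nonadjacent, \<open>r\<close> would be pendant at \<open>x\<close> on the
    cycle \<open>x u q v\<close>.\<close>
  have same_pair: "E u v" if "u \<noteq> v" "E u p" "E u q" "\<not> E u r" "E v p" "E v q" "\<not> E v r"
    "\<not> E p q" "\<not> E p r" "\<not> E q r" "E x p" "E x r" "\<not> E x q" for u v p q r x
    using two_pairs[of u p q r x] two_pairs[of v p q r x] banner[of x u q v r] that by (auto simp: sym_iff)
  have triples: "E u v" if "u \<in> V" "v \<in> V" "u \<noteq> v" "E u a" "E u b" "E u c" "E v a" "E v b" "E v c" for u v
    using no_K23[of a b c u v] that abc by blast
  have ba: "\<not> E b a" "\<not> E c a" "\<not> E c b" using abc sym by blast+
  show ?thesis
    unfolding complete_def
  proof (intro ballI impI)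
    fix u v assume u: "u \<in> dual_nbhd a b c" and v: "v \<in> dual_nbhd a b c" and uv: "u \<noteq> v"
    have V: "u \<in> V" "v \<in> V" using u v unfolding dual_nbhd_def by auto
    consider "E u a" "E u b" "E u c" | "E u a" "E u b" "\<not> E u c" | "E u a" "\<not> E u b" "E u c"
      | "\<not> E u a" "E u b" "E u c" using u unfolding dual_nbhd_def by blast
    note u_cases = this
    consider "E v a" "E v b" "E v c" | "E v a" "E v b" "\<not> E v c" | "E v a" "\<not> E v b" "E v c"
      | "\<not> E v a" "E v b" "E v c" using v unfolding dual_nbhd_def by blast
    note v_cases = this
    have vu: "v \<noteq> u" using uv by simp
    show "E u v"
    proof (cases rule: u_cases)
      case u: 1
      show ?thesis
      proof (cases rule: v_cases)
        case 1 show ?thesis by (rule triples[OF V uv u 1])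
      next
        case 2 show ?thesis by (rule triple_pair[OF uv u 2 abc(7-9,4)])
      next
        case 3 show ?thesis by (rule triple_pair[OF uv u(1,3,2) 3(1,3,2) abc(8,7) ba(3) abc(5)])
      next
        case 4 show ?thesis by (rule triple_pair[OF uv u(2,3,1) 4(2,3,1) abc(9) ba(1,2) abc(6)])
      qed
    next
      case u: 2
      show ?thesis
      proof (cases rule: v_cases)
        case 1 show ?thesis by (rule sym[OF triple_pair[OF vu 1 u abc(7-9,4)]])
      next
        case 2 show ?thesis by (rule same_pair[OF uv u 2 abc(7-9) w(6-8)])
      next
        case 3 show ?thesis by (rule two_pairs[OF u 3(1,3,2) abc(7-9)])
      next
        case 4 show ?thesis by (rule two_pairs[OF u(2,1,3) 4(2,3,1) ba(1) abc(9,8)])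
      qed
    next
      case u: 3
      show ?thesis
      proof (cases rule: v_cases)
        case 1 show ?thesis
          by (rule sym[OF triple_pair[OF vu 1(1,3,2) u(1,3,2) abc(8,7) ba(3) abc(5)]])
      next
        case 2 show ?thesis by (rule two_pairs[OF u(1,3,2) 2 abc(8,7) ba(3)])
      next
        case 3 show ?thesis by (rule same_pair[OF uv u(1,3,2) 3(1,3,2) abc(8,7) ba(3) w(2-4)])
      next
        case 4 show ?thesis by (rule two_pairs[OF u(3,1,2) 4(3,2,1) ba(2,3) abc(7)])
      qed
    next
      case u: 4
      show ?thesis
      proof (cases rule: v_cases)
        case 1 show ?thesis
          by (rule sym[OF triple_pair[OF vu 1(2,3,1) u(2,3,1) abc(9) ba(1,2) abc(6)]])
      next
        case 2 show ?thesis by (rule two_pairs[OF u(2,3,1) 2(2,1,3) abc(9) ba(1,2)])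
      next
        case 3 show ?thesis by (rule two_pairs[OF u(3,2,1) 3(3,1,2) ba(3,2,1)])
      next
        case 4 show ?thesis by (rule same_pair[OF uv u(2,3,1) 4(2,3,1) abc(9) ba(1,2) w(3,2,4)])
      qed
    qed
  qed
qed

text \<open>A triple with the largest \<open>dual_nbhd\<close> is impossible: this set is a clique, hence no cutset, so
  there is an induced path \<open>b, x, y, c\<close> avoiding it, and the triple \<open>x, a, c\<close> has a larger one.\<close>

lemma no_two_dual_classes:
  assumes "a \<in> V" "b \<in> V" "c \<in> V" "a \<noteq> b" "a \<noteq> c" "b \<noteq> c" "\<not> E a b" "\<not> E a c" "\<not> E b c"
    and "w \<in> V" "E w a" "E w b" "\<not> E w c" "w' \<in> V" "E w' a" "E w' c" "\<not> E w' b"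
  shows False
  using assms
proof (induction "card V - card (dual_nbhd a b c)" arbitrary: a b c w w' rule: less_induct)
  case less
  define K where "K = dual_nbhd a b c"
  have K: "x \<in> K \<longleftrightarrow> x \<in> V \<and> (E x a \<and> E x b \<or> E x a \<and> E x c \<or> E x b \<and> E x c)" for x
    unfolding K_def dual_nbhd_def by simp
  note abc = less.prems(1-9) and w = less.prems(10-13) and w' = less.prems(14-17)
  have ba: "\<not> E b a" "\<not> E c a" "\<not> E c b" using abc sym by blast+
  have "complete K"
    unfolding K_def by (rule dual_nbhd_complete) fact+
  moreover have KV: "K \<subseteq> V" using K by blast
  ultimately have conn: "conn (V - K)" using no_cutset by blast
  have "a \<notin> K" "b \<notin> K" "c \<notin> K" using K abc ba irrefl by blast+
  then consider z where "z \<in> V - K" "E b z" "E z c"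
    | x y where "x \<in> V - K" "y \<in> V - K" "E b x" "E x y" "E y c" "\<not> E b y" "\<not> E x c"
    using conn_path[OF conn, of b c] abc by blast
  then show False
  proof cases
    case 1
    then show False using K[of z] by (auto simp: sym_iff)
  next
    case 2
    note xy = this
    have xa: "\<not> E x a" "\<not> E y a" using xy K[of x] K[of y] by (auto simp: sym_iff)
    have xyV: "x \<in> V" "y \<in> V" using xy by auto
    have ne: "x \<noteq> a" "x \<noteq> c" "b \<noteq> y" "c \<noteq> x" using xy abc ba sym by blast+
    have kxy: "k \<noteq> x" "k \<noteq> y" if "E k a \<or> E k b \<and> E k c" for k
      using that xa xy sym by blast+
    \<comment> \<open>If \<open>k\<close> misses \<open>x\<close>, either \<open>a k b x y\<close>
      is an induced path or \<open>k\<close> sees \<open>y\<close> and \<open>a\<close> is pendant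
      at \<open>k\<close> on the cycle \<open>k b x y\<close>.\<close>
    have Kx_ab: "E k x" if "E k a" "E k b" "\<not> E k c" for k
      using P5[of a k b x y] banner[of k b x y a] kxy[of k] that ne xy xa abc by (auto simp: sym_iff)
    have Ky_ac: "E k y" if "E k a" "E k c" "\<not> E k b" for k
      using P5[of a k c y x] banner[of k c y x a] kxy[of k] that ne xy xa abc by (auto simp: sym_iff)
    \<comment> \<open>Otherwise \<open>a w' y x b\<close> is an induced path.\<close>
    have w'x: "E w' x"
      using P5[of a w' y x b] Ky_ac[OF w'(2-4)] w' xy xa abc by (auto simp: sym_iff)
    \<comment> \<open>As \<open>K\<close> is a clique, \<open>k\<close> sees \<open>w'\<close>; if
      \<open>k\<close> missed \<open>x\<close>, \<open>a\<close> would be pendant at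
      \<open>w'\<close> on the cycle \<open>w' k b x\<close>.\<close>
    have Kx_bc: "E k x" if "k \<in> K" "E k b" "E k c" "\<not> E k a" for k
    proof -
      have "w' \<in> K" using K w' by blast
      moreover have "w' \<noteq> k" using w' that by blast
      ultimately have "E k w'"
        using \<open>complete K\<close>[unfolded complete_def, rule_format, of k w'] that(1) by simp
      then show ?thesis
        using banner[of w' k b x a] w'x kxy[of k] that ne xy xa w' abc by (auto simp: sym_iff)
    qed
    have "K \<subseteq> dual_nbhd x a c"
    proof
      fix k assume k: "k \<in> K"
      then show "k \<in> dual_nbhd x a c"
        unfolding dual_nbhd_def using K[of k] Kx_ab[of k] Kx_bc[of k] by blast
    qed
    moreover have y: "y \<in> dual_nbhd x a c" "y \<notin> K"
      unfolding dual_nbhd_def using xy by (auto simp: sym_iff)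
    moreover have sub: "dual_nbhd x a c \<subseteq> V" unfolding dual_nbhd_def by blast
    ultimately have "card K < card (dual_nbhd x a c)"
      by (intro psubset_card_mono finite_subset[OF sub fin]) blast
    moreover have "card (dual_nbhd x a c) \<le> card V" using sub fin card_mono by blast
    ultimately have "card V - card (dual_nbhd x a c) < card V - card (dual_nbhd a b c)"
      unfolding K_def by linarith
    \<comment> \<open>In the new triple, \<open>w\<close> sees exactly \<open>x\<close> and
      \<open>a\<close>, and \<open>y\<close> sees exactly \<open>x\<close> and
      \<open>c\<close>.\<close>
    then show False
      using less.hyps[of x a c w y] xyV abc ne xa w Kx_ab[OF w(2-4)] xy sym by blast
  qed
qed

text \<open>Connectedness of the non-neighbourhood of \<open>a\<close> gives a stable triple
  \<open>a\<close>, \<open>b\<close>, \<open>x\<close> and a vertex \<open>m\<close> that sees only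
  \<open>b\<close> and \<open>x\<close>, so no vertex sees exactly another pair. A short path from
  \<open>a\<close> to \<open>x\<close> among the non-neighbours of \<open>b\<close> contradicts this
  or leads to another triple with two such classes.\<close>

lemma no_stable_triple:
  assumes abc: "a \<in> V" "b \<in> V" "c \<in> V" "a \<noteq> b" "a \<noteq> c" "b \<noteq> c" "\<not> E a b" "\<not> E a c" "\<not> E b c"
  shows False
proof -
  let ?N = "\<lambda>v. {x \<in> V. x \<noteq> v \<and> \<not> E v x}"
  let ?A = "{x \<in> ?N a. x = b \<or> E b x}"
  have sub: "?A \<subseteq> ?N a" and b: "b \<in> ?A" and c: "c \<in> ?N a" "c \<notin> ?A"
    using abc by auto
  obtain m x where mx: "m \<in> ?A" "x \<in> ?N a" "x \<notin> ?A" "E m x"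
    using connE[OF non_nbhd_conn[OF abc(1)] sub b c] .
  then have x: "x \<in> V" "x \<noteq> a" "\<not> E a x" "x \<noteq> b" "\<not> E b x" by auto
  have m: "m \<in> V" "E b m" "\<not> E a m" using mx x by auto
  have no: "\<not> (E w b \<and> E w a \<and> \<not> E w x)" "\<not> (E w x \<and> E w a \<and> \<not> E w b)" if "w \<in> V" for w
    using no_two_dual_classes[of b a x w m] no_two_dual_classes[of x a b w m] that m x mx(4) abc
    by (auto simp: sym_iff)
  have a: "a \<in> ?N b" and xN: "x \<in> ?N b" using abc x by (auto simp: sym_iff)
  consider w where "w \<in> ?N b" "E a w" "E w x"
    | s t where "s \<in> ?N b" "t \<in> ?N b" "E a s" "E s t" "E t x" "\<not> E a t" "\<not> E s x"
    using conn_path[OF non_nbhd_conn[OF abc(2)] a xN] x by blast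
  then show False
  proof cases
    case 1
    then show False using no(2)[of w] by (auto simp: sym_iff)
  next
    case 2
    \<comment> \<open>If \<open>s\<close> misses \<open>m\<close>, then \<open>b m t s a\<close> or
      \<open>b m x t s\<close> is an induced path, according to whether \<open>t\<close> sees
      \<open>m\<close>.\<close>
    have sm: "E s m"
      using P5[of b m x t s] P5[of b m t s a] 2 m x mx(4) abc by (auto simp: sym_iff)
    \<comment> \<open>Otherwise \<open>a\<close> is pendant at \<open>s\<close> on the cycle
      \<open>s t x m\<close>.\<close>
    have tm: "E t m"
      using banner[of s t x m a] 2 m x mx(4) sm abc by (auto simp: sym_iff)
    have "t \<noteq> a" using 2 x by blast
    \<comment> \<open>In the stable triple \<open>t\<close>, \<open>a\<close>, \<open>b\<close>, the
      vertex \<open>s\<close> sees exactly \<open>t\<close> and \<open>a\<close>, and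
      \<open>m\<close> exactly \<open>t\<close> and \<open>b\<close>.\<close>
    then show False
      using no_two_dual_classes[of t a b s m] 2 m x mx(4) tm abc by (auto simp: sym_iff)
  qed
qed

end

section \<open>Colourings and the join of two graphs\<close>

context simple_adjacency
begin

definition colorable :: "'a set \<Rightarrow> nat \<Rightarrow> bool" where
  "colorable U k \<longleftrightarrow> (\<exists>c. c ` U \<subseteq> {..<k} \<and> (\<forall>u\<in>U. \<forall>v\<in>U. E u v \<longrightarrow> c u \<noteq> c v))"

definition deg :: "'a set \<Rightarrow> 'a \<Rightarrow> nat" where
  "deg U v = card {u \<in> U. E v u}"

definition Delta :: "'a set \<Rightarrow> nat" where
  "Delta U = Max (insert 0 (deg U ` U))"

definition omega :: "'a set \<Rightarrow> nat" where
  "omega U = Max (card ` {K. K \<subseteq> U \<and> complete K})"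

lemma colorable_mono: "colorable U k \<Longrightarrow> W \<subseteq> U \<Longrightarrow> k \<le> l \<Longrightarrow> colorable W l"
  unfolding colorable_def image_subset_iff lessThan_iff by (meson less_le_trans subsetD)

lemma colorable_card:
  assumes "finite U" shows "colorable U (card U)"
proof -
  obtain f where f: "inj_on f U" "f ` U = {..<card U}"
    using finite_same_card_bij[OF assms, of "{..<card U}"] by (auto simp: bij_betw_def)
  have "f u \<noteq> f v" if "u \<in> U" "v \<in> U" "E u v" for u v
    using inj_onD[OF f(1), of u v] that irrefl by blast
  then show ?thesis
    unfolding colorable_def using f(2) by blast
qed

lemma colorable_union:
  assumes "colorable A k" "colorable B l"
  shows "colorable (A \<union> B) (k + l)"
proof -
  obtain c where c: "c ` A \<subseteq> {..<k}" "\<forall>u\<in>A. \<forall>v\<in>A. E u v \<longrightarrow> c u \<noteq> c v"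
    using assms(1) unfolding colorable_def by (elim exE conjE)
  obtain d where d: "d ` B \<subseteq> {..<l}" "\<forall>u\<in>B. \<forall>v\<in>B. E u v \<longrightarrow> d u \<noteq> d v"
    using assms(2) unfolding colorable_def by (elim exE conjE)
  let ?e = "\<lambda>x. if x \<in> A then c x else k + d x"
  have "?e ` (A \<union> B) \<subseteq> {..<k + l}"
    using c(1) d(1) by (auto simp: image_subset_iff trans_less_add1)
  moreover have "?e u \<noteq> ?e v" if uv: "u \<in> A \<union> B" "v \<in> A \<union> B" "E u v" for u v
  proof -
    have "c x < k" if "x \<in> A" for x using c(1) that by auto
    then have "c x \<noteq> k + n" "k + n \<noteq> c x" if "x \<in> A" for x n using that by fastforce+
    then show ?thesis
      using c(2)[rule_format, of u v] d(2)[rule_format, of u v] uv by (cases "u \<in> A"; cases "v \<in> A") auto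
  qed
  ultimately show ?thesis unfolding colorable_def by blast
qed

text \<open>Both colourings are injective on the clique \<open>K\<close>, so permuting the colours
  of one makes them agree there.\<close>

lemma colorable_clique_cutset:
  assumes "colorable (K \<union> A) k" "colorable (K \<union> B) k" "complete K"
    and sep: "\<And>a b. a \<in> A \<Longrightarrow> b \<in> B \<Longrightarrow> \<not> E a b"
  shows "colorable (K \<union> A \<union> B) k"
proof -
  obtain c where c: "c ` (K \<union> A) \<subseteq> {..<k}" "\<forall>u\<in>K \<union> A. \<forall>v\<in>K \<union> A. E u v \<longrightarrow> c u \<noteq> c v"
    using assms(1) unfolding colorable_def by (elim exE conjE)
  obtain d where d: "d ` (K \<union> B) \<subseteq> {..<k}" "\<forall>u\<in>K \<union> B. \<forall>v\<in>K \<union> B. E u v \<longrightarrow> d u \<noteq> d v"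
    using assms(2) unfolding colorable_def by (elim exE conjE)
  have inj: "inj_on c K" "inj_on d K"
    using c(2) d(2) assms(3) unfolding inj_on_def complete_def by (metis UnI1)+
  have sub: "c ` K \<subseteq> {..<k}" "d ` K \<subseteq> {..<k}" using c(1) d(1) by auto
  have "card ({..<k} - d ` K) = card ({..<k} - c ` K)"
    using sub inj by (simp add: card_Diff_subset finite_subset card_image)
  then obtain h where h: "bij_betw h ({..<k} - d ` K) ({..<k} - c ` K)"
    using finite_same_card_bij by blast
  have g: "bij_betw (c \<circ> inv_into K d) (d ` K) (c ` K)"
    using inj by (intro bij_betw_trans[of _ _ K] bij_betw_inv_into) (auto simp: bij_betw_def)
  \<comment> \<open>\<open>p\<close> sends the \<open>d\<close>-colour of each vertex of
    \<open>K\<close> to its \<open>c\<close>-colour, and the remaining colours bijectively to the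
    remaining ones.\<close>
  define p where "p = (\<lambda>i. if i \<in> d ` K then (c \<circ> inv_into K d) i else h i)"
  have "bij_betw p (d ` K) (c ` K)"
    using g by (rule bij_betw_cong[THEN iffD1, rotated]) (simp add: p_def)
  moreover have "bij_betw p ({..<k} - d ` K) ({..<k} - c ` K)"
    using h by (rule bij_betw_cong[THEN iffD1, rotated]) (simp add: p_def)
  ultimately have "bij_betw p (d ` K \<union> ({..<k} - d ` K)) (c ` K \<union> ({..<k} - c ` K))"
    by (rule bij_betw_combine) auto
  then have p: "bij_betw p {..<k} {..<k}"
    using sub by (simp add: Un_absorb1)
  have pK: "p (d x) = c x" if "x \<in> K" for x
    using that inj by (simp add: p_def)
  let ?e = "\<lambda>x. if x \<in> K \<union> A then c x else p (d x)"
  have "?e ` (K \<union> A \<union> B) \<subseteq> {..<k}"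
  proof -
    have "c x < k" if "x \<in> K \<union> A" for x using c(1) that by blast
    moreover have "p (d x) < k" if "x \<in> K \<union> B" for x
      using bij_betwE[OF p] d(1) that by blast
    ultimately show ?thesis by auto
  qed
  moreover have pd: "p (d u) \<noteq> p (d v)" if "u \<in> K \<union> B" "v \<in> K \<union> B" "E u v" for u v
  proof -
    have "d u \<in> {..<k}" "d v \<in> {..<k}" "d u \<noteq> d v" using d that by blast+
    then show ?thesis using inj_onD[OF bij_betw_imp_inj_on[OF p]] by blast
  qed
  moreover have "?e u \<noteq> ?e v" if uv: "u \<in> K \<union> A \<union> B" "v \<in> K \<union> A \<union> B" "E u v" for u v
  proof (cases "u \<in> K \<union> A")
    case True
    show ?thesis
    proof (cases "v \<in> K \<union> A")
      case True then show ?thesis using c(2) \<open>u \<in> K \<union> A\<close> uv(3) by simp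
    next
      case False
      then have "v \<in> B" using uv by blast
      then have "u \<in> K" using sep uv(3) True by blast
      then show ?thesis using pd[of u v] pK[of u] uv(3) \<open>v \<in> B\<close> False by auto
    qed
  next
    case False
    then have "u \<in> B" using uv by blast
    then have "v \<in> K \<union> B" "v \<notin> A" if "v \<notin> K" using sep uv sym that by blast+
    then show ?thesis
      using pd[of u v] pK[of v] uv(3) \<open>u \<in> B\<close> False by (cases "v \<in> K") auto
  qed
  ultimately show ?thesis unfolding colorable_def by blast
qed

section \<open>Maximum degree, clique number and the bound under joins\<close>

lemma deg_le_Delta: "finite U \<Longrightarrow> v \<in> U \<Longrightarrow> deg U v \<le> Delta U"
  unfolding Delta_def by (intro Max_ge) auto

lemma Delta_le:
  assumes "finite U" "\<And>v. v \<in> U \<Longrightarrow> deg U v \<le> d" shows "Delta U \<le> d"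
  unfolding Delta_def using assms by (intro Max.boundedI) auto

lemma deg_mono: "finite U \<Longrightarrow> W \<subseteq> U \<Longrightarrow> deg W v \<le> deg U v"
  unfolding deg_def by (intro card_mono) auto

lemma Delta_mono: "finite U \<Longrightarrow> W \<subseteq> U \<Longrightarrow> Delta W \<le> Delta U"
  by (meson Delta_le deg_le_Delta deg_mono finite_subset le_trans subsetD)

lemma card_le_omega: "finite U \<Longrightarrow> K \<subseteq> U \<Longrightarrow> complete K \<Longrightarrow> card K \<le> omega U"
  unfolding omega_def by (intro Max_ge) auto

lemma omega_attained:
  assumes "finite U"
  obtains K where "K \<subseteq> U" "complete K" "card K = omega U"
proof -
  have "{} \<in> {K. K \<subseteq> U \<and> complete K}" by (simp add: complete_def)
  then have "omega U \<in> card ` {K. K \<subseteq> U \<and> complete K}"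
    unfolding omega_def using assms by (intro Max_in) auto
  then show thesis using that by force
qed

lemma omega_mono: "finite U \<Longrightarrow> W \<subseteq> U \<Longrightarrow> omega W \<le> omega U"
  by (metis card_le_omega finite_subset omega_attained subset_trans)

lemma omega_join:
  assumes "finite A" "finite B" "A \<inter> B = {}" "\<And>a b. a \<in> A \<Longrightarrow> b \<in> B \<Longrightarrow> E a b"
  shows "omega A + omega B \<le> omega (A \<union> B)"
proof -
  obtain K L where K: "K \<subseteq> A" "complete K" "card K = omega A"
    and L: "L \<subseteq> B" "complete L" "card L = omega B"
    using omega_attained assms(1,2) by metis
  have "complete (K \<union> L)"
    using K L assms(4) sym unfolding complete_def by blast
  moreover have "card (K \<union> L) = card K + card L"
    using K(1) L(1) assms by (intro card_Un_disjoint) (auto intro: finite_subset)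
  ultimately show ?thesis
    using card_le_omega[of "A \<union> B" "K \<union> L"] K L assms(1,2) by auto
qed

text \<open>The ceiling of half of \<open>Delta U + omega U + 1\<close>, written with natural
  division.\<close>

definition reed_bound :: "'a set \<Rightarrow> nat" where
  "reed_bound U = (Delta U + omega U + 2) div 2"

lemma reed_bound_mono: "finite U \<Longrightarrow> W \<subseteq> U \<Longrightarrow> reed_bound W \<le> reed_bound U"
  unfolding reed_bound_def by (intro div_le_mono add_mono Delta_mono omega_mono) auto

text \<open>Deleting a vertex adjacent to all others lowers both \<open>Delta\<close> and
  \<open>omega\<close>, so the bound pays for its colour. Without such a vertex, the bounds of the
  two sides add up to at most the bound of the join.\<close>

lemma reed_bound_join:
  assumes fin: "finite V" and AB: "V = A \<union> B" "A \<inter> B = {}" "A \<noteq> {}" "B \<noteq> {}"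
    and join: "\<And>a b. a \<in> A \<Longrightarrow> b \<in> B \<Longrightarrow> E a b"
    and IH: "\<And>W. W \<subset> V \<Longrightarrow> colorable W (reed_bound W)"
  shows "colorable V (reed_bound V)"
proof (cases "\<exists>v\<in>V. \<forall>u\<in>V. u \<noteq> v \<longrightarrow> E v u")
  case True
  then obtain v where v: "v \<in> V" "\<And>u. u \<in> V \<Longrightarrow> u \<noteq> v \<Longrightarrow> E v u" by blast
  let ?W = "V - {v}"
  have finW: "finite ?W" "finite {v}" using fin by auto
  have Vv: "?W \<union> {v} = V" using v by blast
  have W: "colorable ?W (reed_bound ?W)" using IH v by blast
  have "colorable {v} 1" using colorable_card[of "{v}"] by simp
  then have col: "colorable V (reed_bound ?W + 1)"
    using colorable_union[OF W] Vv by metis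
  have "{u \<in> V. E v u} = ?W" using v irrefl by blast
  then have "card ?W \<le> Delta V" using deg_le_Delta[OF fin v(1)] unfolding deg_def by simp
  moreover have "Delta ?W \<le> card ?W - 1"
  proof (rule Delta_le[OF finW(1)])
    fix u assume u: "u \<in> ?W"
    have "{w \<in> ?W. E u w} \<subseteq> ?W - {u}" using irrefl by blast
    then have "deg ?W u \<le> card (?W - {u})" unfolding deg_def using finW by (intro card_mono) auto
    then show "deg ?W u \<le> card ?W - 1" using u finW by simp
  qed
  \<comment> \<open>As \<open>?W\<close> is nonempty, \<open>card ?W - 1\<close> is truly smaller
    than \<open>card ?W\<close>, so the maximum degree drops.\<close>
  moreover have "card ?W \<noteq> 0"
  proof -
    obtain a b where "a \<in> A" "b \<in> B" using AB(3,4) by blast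
    then have "a \<noteq> b" "a \<in> V" "b \<in> V" using AB by blast+
    then have "?W \<noteq> {}" by blast
    then show ?thesis using finW by simp
  qed
  moreover have "omega ?W + omega {v} \<le> omega V"
    using omega_join[OF finW] v(2) sym Vv by auto
  moreover have "1 \<le> omega {v}"
    using card_le_omega[of "{v}" "{v}"] by (simp add: complete_def)
  ultimately have "reed_bound ?W + 1 \<le> reed_bound V" unfolding reed_bound_def by linarith
  then show ?thesis using colorable_mono[OF col] by blast
next
  case False
  have finAB: "finite A" "finite B" using fin AB by auto
  \<comment> \<open>A vertex of \<open>P\<close> misses itself and, not being adjacent to all
    others, one more vertex, which must lie in \<open>P\<close>.\<close>
  have Delta_part: "Delta P + 2 \<le> card P" if P: "V = P \<union> Q" "P \<noteq> {}"
    "\<And>a b. a \<in> P \<Longrightarrow> b \<in> Q \<Longrightarrow> E a b" for P Q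
  proof -
    have finP: "finite P" using fin P by simp
    have d: "deg P u + 2 \<le> card P" if "u \<in> P" for u
    proof -
      have "u \<in> V" using that P(1) by simp
      then obtain w where w: "w \<in> V" "w \<noteq> u" "\<not> E u w" using False by blast
      then have "w \<in> P" using P(1) P(3)[OF that, of w] by auto
      have "{x \<in> P. E u x} \<subseteq> P - {u, w}" using irrefl w by blast
      then have "deg P u \<le> card (P - {u, w})" unfolding deg_def using finP by (intro card_mono) auto
      moreover have "card (P - {u, w}) = card P - 2"
        using that \<open>w \<in> P\<close> w(2) by (subst card_Diff_subset) auto
      moreover have "card {u, w} \<le> card P" using that \<open>w \<in> P\<close> finP by (intro card_mono) auto
      ultimately show ?thesis using w by simp
    qed
    obtain u where "u \<in> P" using P by blast
    then have "2 \<le> card P" using d[of u] by simp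
    moreover have "Delta P \<le> card P - 2" using d by (intro Delta_le finP) fastforce
    ultimately show ?thesis by simp
  qed
  have "Delta B + 2 \<le> card B" using Delta_part[of B A] AB join sym by blast
  moreover have "Delta A + card B \<le> Delta V"
  proof -
    have "deg V u = deg A u + card B" if "u \<in> A" for u
    proof -
      have "{x \<in> V. E u x} = {x \<in> A. E u x} \<union> B" using AB join that by blast
      then show ?thesis unfolding deg_def using finAB AB(2) by (auto intro!: card_Un_disjoint)
    qed
    then have "deg A u + card B \<le> Delta V" if "u \<in> A" for u
      using deg_le_Delta[OF fin, of u] that AB by auto
    moreover have "card B \<le> Delta V" using calculation AB by fastforce
    ultimately have "Delta A \<le> Delta V - card B"
      by (intro Delta_le finAB) (simp add: le_diff_conv2)
    then show ?thesis using \<open>card B \<le> Delta V\<close> by simp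
  qed
  moreover have "omega A + omega B \<le> omega V"
    using omega_join[OF finAB AB(2) join] AB(1) by simp
  \<comment> \<open>The \<open>2\<close> in \<open>Delta B + 2 \<le> card B\<close> pays for the
    second \<open>+ 2\<close> in the sum of the two bounds.\<close>
  ultimately have le: "reed_bound A + reed_bound B \<le> reed_bound V"
    unfolding reed_bound_def by linarith
  have "A \<subset> V" "B \<subset> V" using AB by blast+
  then have "colorable V (reed_bound A + reed_bound B)" using colorable_union IH AB by metis
  then show ?thesis using colorable_mono le by blast
qed

section \<open>Matchings of the complement and Gallai's lemma\<close>

definition comatching :: "'a set \<Rightarrow> 'a set set \<Rightarrow> bool" where
  "comatching U M \<longleftrightarrow> (\<forall>e\<in>M. \<exists>x\<in>U. \<exists>y\<in>U. x \<noteq> y \<and> \<not> E x y \<and> e = {x, y}) \<and>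
    (\<forall>e\<in>M. \<forall>f\<in>M. e \<noteq> f \<longrightarrow> e \<inter> f = {})"

lemma comatching_edgeE:
  assumes "comatching U M" "e \<in> M"
  obtains x y where "x \<in> U" "y \<in> U" "x \<noteq> y" "\<not> E x y" "e = {x, y}"
proof -
  have "\<exists>x\<in>U. \<exists>y\<in>U. x \<noteq> y \<and> \<not> E x y \<and> e = {x, y}"
    using assms unfolding comatching_def by simp
  then show thesis using that by blast
qed

lemma comatchingE:
  assumes "comatching U M" "x \<in> \<Union>M"
  obtains y where "{x, y} \<in> M" "x \<in> U" "y \<in> U" "x \<noteq> y" "\<not> E x y"
proof -
  obtain e where e: "e \<in> M" "x \<in> e" using assms(2) by blast
  obtain p q where pq: "p \<in> U" "q \<in> U" "p \<noteq> q" "\<not> E p q" "e = {p, q}"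
    by (rule comatching_edgeE[OF assms(1) e(1)])
  then consider "x = p" | "x = q" using e(2) by blast
  then show thesis
  proof cases
    case 1 then show thesis using that[of q] pq e(1) by simp
  next
    case 2 then show thesis using that[of p] pq e(1) sym by (auto simp: insert_commute)
  qed
qed

lemma comatching_disjoint:
  "comatching U M \<Longrightarrow> e \<in> M \<Longrightarrow> f \<in> M \<Longrightarrow> x \<in> e \<Longrightarrow> x \<in> f \<Longrightarrow> e = f"
  unfolding comatching_def by blast

lemma comatching_subset: "comatching U M \<Longrightarrow> N \<subseteq> M \<Longrightarrow> comatching U N"
  unfolding comatching_def by (meson subsetD)

lemma comatching_mono: "comatching W M \<Longrightarrow> W \<subseteq> U \<Longrightarrow> comatching U M"
  unfolding comatching_def by (meson subsetD)

lemma comatching_insert: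
  assumes "comatching U M" "x \<in> U" "y \<in> U" "x \<noteq> y" "\<not> E x y" "x \<notin> \<Union>M" "y \<notin> \<Union>M"
  shows "comatching U (insert {x, y} M)"
  unfolding comatching_def
proof (intro conjI ballI impI)
  fix e assume "e \<in> insert {x, y} M"
  then consider "e = {x, y}" | "e \<in> M" by blast
  then show "\<exists>x\<in>U. \<exists>y\<in>U. x \<noteq> y \<and> \<not> E x y \<and> e = {x, y}"
  proof cases
    case 1 then show ?thesis using assms(2-5) by blast
  next
    case 2 then show ?thesis using assms(1) unfolding comatching_def by simp
  qed
next
  fix e f assume ef: "e \<in> insert {x, y} M" "f \<in> insert {x, y} M" "e \<noteq> f"
  have "{x, y} \<inter> g = {}" "g \<inter> {x, y} = {}" if "g \<in> M" for g using assms(6,7) that by blast+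
  moreover have "e \<inter> f = {}" if "e \<in> M" "f \<in> M"
    using assms(1) that ef(3) unfolding comatching_def by simp
  ultimately show "e \<inter> f = {}" using ef by (elim insertE) simp_all
qed

lemma Union_comatching: "comatching U M \<Longrightarrow> \<Union>M \<subseteq> U"
  using comatchingE by (metis subsetI)

lemma card_Union_comatching:
  assumes "finite U" "comatching U M"
  shows "finite M" "card (\<Union>M) = 2 * card M"
proof -
  have "M \<subseteq> Pow U" using Union_comatching[OF assms(2)] by blast
  then show "finite M" using assms(1) finite_subset by blast
  have card2: "finite e \<and> card e = 2" if "e \<in> M" for e
  proof -
    obtain p q where "p \<noteq> q" "e = {p, q}"
      by (rule comatching_edgeE[OF assms(2) \<open>e \<in> M\<close>])
    then show ?thesis by simp
  qed
  have "pairwise disjnt M"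
    using assms(2) unfolding comatching_def pairwise_def disjnt_def by simp
  then have "card (\<Union>M) = sum card M" using card2 by (intro card_Union_disjoint) auto
  then show "card (\<Union>M) = 2 * card M" using card2 by simp
qed

section \<open>Passing between colourings and matchings of the complement\<close>

text \<open>Each matched pair is a colour class, and every other vertex gets a colour of its
  own.\<close>

lemma colorable_comatching:
  assumes "finite U" "comatching U M"
  shows "colorable U (card U - card M)"
  using assms
proof (induction "card M" arbitrary: U M)
  case 0
  then show ?case using colorable_card by simp
next
  case (Suc n)
  from Suc.hyps(2) have "M \<noteq> {}" by auto
  then obtain e where e: "e \<in> M" by blast
  obtain p q where pq: "p \<in> U" "q \<in> U" "p \<noteq> q" "\<not> E p q" "e = {p, q}"
    by (rule comatching_edgeE[OF Suc.prems(2) e])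
  let ?U = "U - e" and ?M = "M - {e}"
  have finM: "finite M" using card_Union_comatching Suc.prems by blast
  have disj: "f \<inter> e = {}" if "f \<in> ?M" for f
    using Suc.prems(2) e that unfolding comatching_def by simp
  have "comatching ?U ?M"
    unfolding comatching_def
  proof (intro conjI ballI impI)
    fix f assume f: "f \<in> ?M"
    obtain x y where "x \<in> U" "y \<in> U" "x \<noteq> y" "\<not> E x y" "f = {x, y}"
      by (rule comatching_edgeE[OF Suc.prems(2) DiffD1[OF f]])
    moreover have "x \<notin> e" "y \<notin> e" using disj[OF f] calculation by auto
    ultimately show "\<exists>x\<in>?U. \<exists>y\<in>?U. x \<noteq> y \<and> \<not> E x y \<and> f = {x, y}" by blast
  next
    fix f g assume "f \<in> ?M" "g \<in> ?M" "f \<noteq> g"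
    then show "f \<inter> g = {}" using Suc.prems(2) unfolding comatching_def by simp
  qed
  moreover have n: "n = card ?M" using Suc.hyps(2) e finM by simp
  ultimately have col: "colorable ?U (card ?U - n)"
    using Suc.hyps(1)[of ?M ?U] Suc.prems(1) by simp
  have "\<not> E q p" using pq(4) sym by blast
  then have "colorable e 1"
    unfolding colorable_def pq(5) using irrefl pq(4) by (intro exI[of _ "\<lambda>_. 0"]) auto
  then have "colorable (?U \<union> e) (card ?U - n + 1)" using colorable_union[OF col] by blast
  moreover have "?U \<union> e = U" using pq by blast
  moreover have "card ?U = card U - 2" using pq by (simp add: card_Diff_subset)
  \<comment> \<open>This keeps the truncated subtractions exact.\<close>
  moreover have "2 * Suc n \<le> card U"
    using card_Union_comatching(2)[OF Suc.prems] Suc.hyps(2)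
      card_mono[OF Suc.prems(1) Union_comatching[OF Suc.prems(2)]] by simp
  ultimately show ?case using Suc.hyps(2) colorable_mono[of U _ U] by simp
qed

text \<open>Without stable triples a colour class has at most two vertices; the classes of size two
  form the matching. The induction removes the last class.\<close>

lemma comatching_of_coloring:
  assumes "finite W" "colorable W k"
    and "\<And>a b c. a \<in> W \<Longrightarrow> b \<in> W \<Longrightarrow> c \<in> W \<Longrightarrow> a \<noteq> b \<Longrightarrow> a \<noteq> c \<Longrightarrow> b \<noteq> c \<Longrightarrow>
      \<not> E a b \<Longrightarrow> \<not> E a c \<Longrightarrow> \<not> E b c \<Longrightarrow> False"
  shows "\<exists>M. comatching W M \<and> card W \<le> card M + k"
  using assms
proof (induction k arbitrary: W)
  case 0
  then have "W = {}" unfolding colorable_def by auto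
  then show ?case by (auto simp: comatching_def)
next
  case (Suc k)
  obtain c where c: "c ` W \<subseteq> {..<Suc k}" "\<forall>u\<in>W. \<forall>v\<in>W. E u v \<longrightarrow> c u \<noteq> c v"
    using Suc.prems(2) unfolding colorable_def by (elim exE conjE)
  let ?S = "{x \<in> W. c x = k}"
  let ?W = "W - ?S"
  have "c x < k" if "x \<in> ?W" for x
  proof -
    have "c x < Suc k" using c(1) that by blast
    then show ?thesis using that by (auto simp: less_Suc_eq)
  qed
  then have "colorable ?W k" unfolding colorable_def using c(2) by (intro exI[of _ c]) auto
  then obtain M where M: "comatching ?W M" "card ?W \<le> card M + k"
    using Suc.IH[of ?W] Suc.prems(1,3) by (metis (no_types, lifting) Diff_iff finite_Diff)
  have finS: "finite ?S" using Suc.prems(1) by simp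
  have cW: "card W = card ?W + card ?S"
    using Suc.prems(1) finS by (subst card_Diff_subset) (auto simp: card_mono)
  have MW: "comatching W M" using comatching_mono[OF M(1)] by blast
  have stable: "\<not> E x y" if "x \<in> ?S" "y \<in> ?S" for x y
    using c(2)[rule_format, of x y] that by auto
  show ?case
  proof (cases "card ?S \<le> 1")
    case True
    then have "card W \<le> card M + Suc k" using cW M(2) by linarith
    then show ?thesis using MW by blast
  next
    case False
    then obtain x y where xy: "x \<in> ?S" "y \<in> ?S" "x \<noteq> y"
      using card_le_Suc0_iff_eq[OF finS] by auto
    have "z \<in> {x, y}" if "z \<in> ?S" for z
      using Suc.prems(3)[of x y z] xy that stable[OF xy(1,2)] stable[OF xy(1) that]
        stable[OF xy(2) that] by auto
    then have "?S = {x, y}" using xy by blast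
    then have "card ?S = 2" using xy(3) by simp
    have un: "x \<notin> \<Union>M" "y \<notin> \<Union>M" using Union_comatching[OF M(1)] xy by blast+
    then have "comatching W (insert {x, y} M)"
      using xy stable[OF xy(1,2)] by (intro comatching_insert[OF MW]) auto
    moreover have "card (insert {x, y} M) = Suc (card M)"
      using un card_Union_comatching(1)[OF Suc.prems(1) MW] by (subst card_insert_disjoint) auto
    ultimately show ?thesis using cW M(2) \<open>card ?S = 2\<close>
      by (intro exI[of _ "insert {x, y} M"]) simp
  qed
qed

text \<open>Among the maximum matchings missing \<open>t\<close>, take one with the largest intersection with \<open>M\<close>;
  an exchange along an edge of \<open>M\<close> enlarges the intersection.\<close>

lemma comatching_exchange:
  assumes fin: "finite U" and max: "\<And>M. comatching U M \<Longrightarrow> card M \<le> m"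
    and M: "comatching U M" "card M = m" "u \<notin> \<Union>M" "v \<notin> \<Union>M" "u \<noteq> v"
    and t: "comatching U N0" "card N0 = m" "t \<notin> \<Union>N0"
    and cov: "\<And>N. comatching U N \<Longrightarrow> card N = m \<Longrightarrow> t \<notin> \<Union>N \<Longrightarrow> u \<in> \<Union>N \<and> v \<in> \<Union>N"
  shows False
proof -
  let ?P = "\<lambda>N. comatching U N \<and> card N = m \<and> t \<notin> \<Union>N"
  have finM: "finite M" using card_Union_comatching(1)[OF fin M(1)] .
  have "\<forall>N. ?P N \<longrightarrow> card (M \<inter> N) < Suc m"
    using M(2) card_mono[OF finM Int_lower1] by (simp add: less_Suc_eq_le)
  then obtain N where N: "?P N" and best: "\<And>N'. ?P N' \<Longrightarrow> card (M \<inter> N') \<le> card (M \<inter> N)"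
    using ex_has_greatest_nat[of ?P N0 "\<lambda>N. card (M \<inter> N)" "Suc m"] t by auto
  have finN: "finite N" using card_Union_comatching(1)[OF fin] N by blast
  have finU: "finite (\<Union>M)" "finite (\<Union>N)"
    using finite_subset[OF Union_comatching fin] M(1) N by auto
  \<comment> \<open>\<open>N\<close> covers two vertices that \<open>M\<close> misses, and both
    cover equally many, so \<open>M\<close> covers two that \<open>N\<close> misses; one of them is
    not \<open>t\<close>.\<close>
  have "{u, v} \<subseteq> \<Union>N - \<Union>M" using cov[of N] N M by blast
  then have "card {u, v} \<le> card (\<Union>N - \<Union>M)" using finU by (intro card_mono) auto
  moreover have "card (\<Union>N - \<Union>M) = card (\<Union>M - \<Union>N)"
  proof -
    have "card (\<Union>N) = card (\<Union>M)" using card_Union_comatching(2)[OF fin] N M(1,2) by simp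
    then show ?thesis using finU by (simp add: card_Diff_subset_Int Int_commute)
  qed
  ultimately have "2 \<le> card (\<Union>M - \<Union>N)" using M(5) by simp
  then have "\<not> \<Union>M - \<Union>N \<subseteq> {t}" using card_mono[of "{t}" "\<Union>M - \<Union>N"] by auto
  then obtain x where x: "x \<in> \<Union>M" "x \<notin> \<Union>N" "x \<noteq> t" by blast
  obtain y where y: "{x, y} \<in> M" "x \<in> U" "y \<in> U" "x \<noteq> y" "\<not> E x y"
    by (rule comatchingE[OF M(1) x(1)])
  have "y \<in> \<Union>N"
  proof (rule ccontr)
    assume "y \<notin> \<Union>N"
    then have "comatching U (insert {x, y} N)" using N y x(2) by (intro comatching_insert) simp_all
    moreover have "{x, y} \<notin> N" using x(2) by blast
    ultimately show False using max[of "insert {x, y} N"] N finN by simp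
  qed
  then obtain f where f: "f \<in> N" "y \<in> f" by blast
  \<comment> \<open>Trading \<open>f\<close> for \<open>{x, y}\<close> keeps the size, and
    \<open>t\<close> stays uncovered because \<open>x\<close> differs from \<open>t\<close> and
    \<open>y\<close> was covered by \<open>N\<close>.\<close>
  let ?N = "insert {x, y} (N - {f})"
  have yN: "y \<notin> \<Union>(N - {f})" using comatching_disjoint[of U N] N f by blast
  have "comatching U ?N"
    using comatching_subset[of U N "N - {f}"] N y x(2) yN by (intro comatching_insert) auto
  moreover have "card ?N = m"
  proof -
    have "{x, y} \<notin> N - {f}" using x(2) by blast
    then have "card ?N = Suc (card (N - {f}))" using finN by simp
    also have "\<dots> = card N" using f(1) finN by (simp only: card.remove[of N f])
    finally show ?thesis using N by simp
  qed
  moreover have "t \<notin> \<Union>?N" using N x(3) \<open>y \<in> \<Union>N\<close> by blast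
  ultimately have "card (M \<inter> ?N) \<le> card (M \<inter> N)" using best by blast
  moreover have "f \<notin> M"
    using comatching_disjoint[OF M(1) y(1), of f y] f x(2) by blast
  then have "M \<inter> ?N = insert {x, y} (M \<inter> N)" using y(1) by blast
  moreover have "{x, y} \<notin> M \<inter> N" using x(2) by blast
  ultimately show False using finM by simp
qed

lemma gallai_lemma:
  assumes fin: "finite U" and "coconn U" and max: "\<And>M. comatching U M \<Longrightarrow> card M \<le> m"
    and miss: "\<And>v. v \<in> U \<Longrightarrow> \<exists>M. comatching U M \<and> card M = m \<and> v \<notin> \<Union>M"
  shows "card U \<le> 2 * m + 1"
proof -
  \<comment> \<open>By the exchange argument \<open>R\<close> is transitive, and non-adjacent vertices are related.\<close>
  define R where "R u v \<longleftrightarrow> u = v \<or> \<not> (\<exists>M. comatching U M \<and> card M = m \<and> u \<notin> \<Union>M \<and> v \<notin> \<Union>M)" for u v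
  have R: "R u v" if u: "u \<in> U" and v: "v \<in> U" for u v
  proof (rule ccontr)
    assume "\<not> R u v"
    moreover have "R u u" unfolding R_def by blast
    ultimately obtain a b where ab: "a \<in> U" "R u a" "b \<in> U" "\<not> R u b" "\<not> E a b"
      using coconnE[OF assms(2), of "{x \<in> U. R u x}" u v] u v by blast
    have "a \<noteq> b" using ab by blast
    \<comment> \<open>A maximum matching missing both ends of a non-edge could be extended by
      it.\<close>
    have Rab: "R a b"
    proof (rule ccontr)
      assume "\<not> R a b"
      then obtain M where M: "comatching U M" "card M = m" "a \<notin> \<Union>M" "b \<notin> \<Union>M"
        unfolding R_def by blast
      then have "comatching U (insert {a, b} M)"
        using comatching_insert ab \<open>a \<noteq> b\<close> by blast
      moreover have "{a, b} \<notin> M" using M(3) by blast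
      ultimately show False
        using max[of "insert {a, b} M"] M(2) card_Union_comatching(1)[OF fin M(1)] by simp
    qed
    then have "u \<noteq> a" using ab by blast
    obtain M where M: "comatching U M" "card M = m" "u \<notin> \<Union>M" "b \<notin> \<Union>M" and "u \<noteq> b"
      using ab(4) unfolding R_def by blast
    obtain N where N: "comatching U N" "card N = m" "a \<notin> \<Union>N" using miss ab(1) by blast
    \<comment> \<open>By \<open>R u a\<close> and \<open>R a b\<close>, whatever misses
      \<open>a\<close> covers \<open>u\<close> and \<open>b\<close>, although \<open>M\<close>
      misses both: the situation excluded by the exchange.\<close>
    have "u \<in> \<Union>N' \<and> b \<in> \<Union>N'" if "comatching U N'" "card N' = m" "a \<notin> \<Union>N'" for N'
      using that ab(2) Rab \<open>u \<noteq> a\<close> \<open>a \<noteq> b\<close> unfolding R_def by blast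
    then show False
      using comatching_exchange[OF fin max M \<open>u \<noteq> b\<close> N] by blast
  qed
  show ?thesis
  proof (cases "U = {}")
    case False
    then obtain M where M: "comatching U M" "card M = m" using miss by blast
    have sub: "\<Union>M \<subseteq> U" using Union_comatching[OF M(1)] .
    have "finite (U - \<Union>M)" using fin by simp
    moreover have "\<forall>x\<in>U - \<Union>M. \<forall>y\<in>U - \<Union>M. x = y" using R M unfolding R_def by blast
    ultimately have "card (U - \<Union>M) \<le> Suc 0" using card_le_Suc0_iff_eq by blast
    moreover have "card (U - \<Union>M) = card U - 2 * m"
      using card_Union_comatching(2)[OF fin M(1)] M(2) card_Diff_subset[OF finite_subset[OF sub fin] sub]
      by simp
    ultimately show ?thesis by simp
  qed simp
qed

end

section \<open>The minimal counterexample\<close>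

context P5_banner_free
begin

lemma colorable_reed_bound:
  "finite V \<Longrightarrow> colorable V (reed_bound V)"
proof (induction "card V" arbitrary: V rule: less_induct)
  case less
  note fin = \<open>finite V\<close>
  have IH: "colorable W (reed_bound W)" if "W \<subset> V" for W
    using less.hyps[of W] psubset_card_mono[OF fin that] finite_subset[of W V] fin that by blast
  then have IH': "colorable W (reed_bound V)" if "W \<subset> V" for W
    using colorable_mono[OF IH[OF that] subset_refl] reed_bound_mono[OF fin, of W] that by blast
  show ?case
  proof (rule ccontr)
    assume ncol: "\<not> colorable V (reed_bound V)"
    have conn: "conn (V - K)" if K: "K \<subseteq> V" "complete K" for K
    proof (rule ccontr)
      assume "\<not> conn (V - K)"
      then obtain A where A: "A \<subseteq> V - K" "A \<noteq> {}" "A \<noteq> V - K"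
        and sep: "\<And>a b. a \<in> A \<Longrightarrow> b \<in> V - K - A \<Longrightarrow> \<not> E a b"
        unfolding conn_def by blast
      have "K \<union> A \<subset> V" "K \<union> (V - K - A) \<subset> V" using A K by blast+
      then have "colorable (K \<union> A \<union> (V - K - A)) (reed_bound V)"
        using colorable_clique_cutset[OF _ _ K(2) sep] IH' by blast
      moreover have "K \<union> A \<union> (V - K - A) = V" using A K by blast
      ultimately show False using ncol by simp
    qed
    have coconn: "coconn V"
    proof (rule ccontr)
      assume "\<not> coconn V"
      then obtain A where A: "A \<subseteq> V" "A \<noteq> {}" "A \<noteq> V"
        and join: "\<And>a b. a \<in> A \<Longrightarrow> b \<in> V - A \<Longrightarrow> E a b"
        unfolding coconn_def by blast
      have "V = A \<union> (V - A)" "A \<inter> (V - A) = {}" "V - A \<noteq> {}" using A by blast+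
      then show False using reed_bound_join[OF fin _ _ A(2) _ join IH] ncol by blast
    qed
    interpret reduced E V
      using fin conn coconn by unfold_locales
    define k where "k = reed_bound V"
    \<comment> \<open>A matching with at least \<open>card V - k\<close> pairs would give a
      colouring with \<open>k\<close> colours.\<close>
    have small: "\<not> card V \<le> card M + k" if "comatching V M" for M
    proof
      assume "card V \<le> card M + k"
      then have "card V - card M \<le> k" by linarith
      then show False
        using colorable_mono[OF colorable_comatching[OF fin that] subset_refl, of k] ncol k_def by simp
    qed
    have "card M \<le> card V - 1 - k" if "comatching V M" for M using small[OF that] by simp
    \<comment> \<open>A \<open>k\<close>-colouring of \<open>V - {v}\<close> gives a matching that
      misses \<open>v\<close> and already attains the upper bound for \<open>V\<close>.\<close>
    moreover have "\<exists>M. comatching V M \<and> card M = card V - 1 - k \<and> v \<notin> \<Union>M" if v: "v \<in> V" for v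
    proof -
      have "colorable (V - {v}) k" using IH'[of "V - {v}"] v k_def by blast
      moreover have "finite (V - {v})" using fin by simp
      ultimately obtain M where M: "comatching (V - {v}) M" "card (V - {v}) \<le> card M + k"
        using comatching_of_coloring[of "V - {v}" k] no_stable_triple by (metis DiffD1)
      have MV: "comatching V M" using comatching_mono[OF M(1)] by blast
      have "card M = card V - 1 - k" using small[OF MV] M(2) v fin by simp
      moreover have "v \<notin> \<Union>M" using Union_comatching[OF M(1)] by blast
      ultimately show ?thesis using MV by blast
    qed
    ultimately have card_le: "card V \<le> 2 * (card V - 1 - k) + 1"
      using gallai_lemma[OF fin coconn, of "card V - 1 - k"] by blast
    \<comment> \<open>The empty matching shows that the subtraction in \<open>card_le\<close> is
      exact, so that \<open>card_le\<close> means \<open>2 * k + 1 \<le> card V\<close>.\<close>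
    have "comatching V {}" by (simp add: comatching_def)
    then have "k < card V" using small[of "{}"] by simp
    then obtain v where v: "v \<in> V" by fastforce
    let ?N = "{x \<in> V. x \<noteq> v \<and> \<not> E v x}"
    have "complete ?N" unfolding complete_def using no_stable_triple[OF v] by blast
    then have "card ?N \<le> omega V" using card_le_omega[OF fin, of ?N] by blast
    moreover have "card {x \<in> V. E v x} \<le> Delta V" using deg_le_Delta[OF fin v] unfolding deg_def .
    moreover have "card V \<le> card (insert v {x \<in> V. E v x}) + card ?N"
    proof -
      have "V = insert v {x \<in> V. E v x} \<union> ?N" using v by blast
      then show ?thesis by (metis card_Un_le)
    qed
    moreover have "card (insert v {x \<in> V. E v x}) \<le> Suc (card {x \<in> V. E v x})"
      by (rule card_insert_le_m1) auto
    ultimately have "card V \<le> Delta V + omega V + 1" by linarith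
    moreover have "Delta V + omega V + 1 \<le> 2 * k" unfolding k_def reed_bound_def by linarith
    ultimately show False using card_le \<open>k < card V\<close> by linarith
  qed
qed

end

section \<open>Translation to the given definitions\<close>

text \<open>\<open>family_free\<close> asks for an isomorphism from the induced subgraph onto
  \<open>H\<close>, so the embedding \<open>g\<close> of \<open>H\<close> is inverted.\<close>

lemma isomorphic_induced_subgraph:
  assumes inj: "inj_on g (verts H)"
    and adj: "\<And>i j. i \<in> verts H \<Longrightarrow> j \<in> verts H \<Longrightarrow> adjacent G (g i) (g j) \<longleftrightarrow> adjacent H i j"
  shows "isomorphic (induced_subgraph G (g ` verts H)) H"
proof -
  let ?f = "inv_into (verts H) g"
  have "bij_betw ?f (g ` verts H) (verts H)"
    using inj by (simp add: bij_betw_inv_into inj_on_imp_bij_betw)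
  moreover have "adjacent (induced_subgraph G (g ` verts H)) u v \<longleftrightarrow> adjacent H (?f u) (?f v)"
    if "u \<in> g ` verts H" "v \<in> g ` verts H" for u v
  proof -
    obtain i j where "i \<in> verts H" "j \<in> verts H" "u = g i" "v = g j" using \<open>u \<in> g ` verts H\<close> \<open>v \<in> g ` verts H\<close> by blast
    then show ?thesis
      using adj[of i j] inj that by (simp add: adjacent_def induced_subgraph_def)
  qed
  ultimately show ?thesis
    unfolding isomorphic_def by (intro exI[of _ ?f]) (simp add: induced_subgraph_def)
qed

lemma family_free_no_embedding:
  assumes "family_free \<F> G" "H \<in> \<F>" "inj_on g (verts H)" "g ` verts H \<subseteq> verts G"
    and "\<And>i j. i \<in> verts H \<Longrightarrow> j \<in> verts H \<Longrightarrow> adjacent G (g i) (g j) \<longleftrightarrow> adjacent H i j"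
  shows False
  using assms isomorphic_induced_subgraph[of g H G] unfolding family_free_def by blast

lemma P5_edge:
  "adjacent P5 i j \<longleftrightarrow>
    (i, j) \<in> {(0, 1), (1, 2), (2, 3), (3, 4), (1, 0), (2, 1), (3, 2), (4, 3)}"
  unfolding adjacent_def P5_def by (auto simp: doubleton_eq_iff)

lemma Flag_compl_edge:
  "adjacent Flag_compl i j \<longleftrightarrow>
    (i, j) \<in> {(0, 1), (1, 2), (2, 3), (3, 0), (0, 4), (1, 0), (2, 1), (3, 2), (0, 3), (4, 0)}"
  unfolding adjacent_def Flag_compl_def by (auto simp: doubleton_eq_iff)

lemma P5_banner_free_adjacent:
  assumes G: "finite_simple_graph G" and free: "family_free {P5, Flag_compl} G"
  shows "P5_banner_free (adjacent G)"
proof -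
  have in_verts: "u \<in> verts G \<and> v \<in> verts G \<and> u \<noteq> v" if "adjacent G u v" for u v
  proof -
    have "{u, v} \<in> [verts G]\<^bsup>2\<^esup>"
      using G that unfolding finite_simple_graph_def adjacent_def by blast
    then have "{u, v} \<subseteq> verts G" "card {u, v} = 2" by (simp_all add: nsets_def)
    then show ?thesis by (cases "u = v") auto
  qed
  interpret simple_adjacency "adjacent G"
  proof unfold_locales
    show "adjacent G y x" if "adjacent G x y" for x y
      using that by (simp add: adjacent_def insert_commute)
    show "\<not> adjacent G x x" for x
      using in_verts by blast
  qed
  show ?thesis
  proof unfold_locales
    fix a b c d e
    assume adj: "adjacent G a b" "adjacent G b c" "adjacent G c d" "adjacent G d e"
      and nadj: "\<not> adjacent G a c" "\<not> adjacent G a d" "\<not> adjacent G a e" "\<not> adjacent G b d"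
        "\<not> adjacent G b e" "\<not> adjacent G c e"
    have nadj': "\<not> adjacent G c a" "\<not> adjacent G d a" "\<not> adjacent G e a" "\<not> adjacent G d b"
        "\<not> adjacent G e b" "\<not> adjacent G e c"
      using nadj sym by blast+
    let ?g = "(!) [a, b, c, d, e]"
    have V: "verts P5 = {0, 1, 2, 3, 4}" by (simp add: P5_def)
    have "a \<noteq> b" "a \<noteq> c" "a \<noteq> d" "a \<noteq> e" "b \<noteq> c" "b \<noteq> d" "b \<noteq> e" "c \<noteq> d" "c \<noteq> e" "d \<noteq> e"
      using adj nadj in_verts sym by blast+
    then have "inj_on ?g (verts P5)" unfolding V by (simp add: inj_on_def)
    moreover have "?g ` verts P5 \<subseteq> verts G" unfolding V using adj in_verts by simp
    moreover have "adjacent G (?g i) (?g j) \<longleftrightarrow> adjacent P5 i j"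
      if "i \<in> verts P5" "j \<in> verts P5" for i j
      using that unfolding V
      by (elim insertE emptyE) (simp_all add: adj nadj adj[THEN sym] nadj' irrefl P5_edge)
    ultimately show False using family_free_no_embedding[OF free, of P5 ?g] by blast
  next
    fix a b c d e
    assume adj: "adjacent G a b" "adjacent G b c" "adjacent G c d" "adjacent G d a" "adjacent G a e"
      and ne: "a \<noteq> c" "b \<noteq> d" and nadj: "\<not> adjacent G a c" "\<not> adjacent G b d"
        "\<not> adjacent G e b" "\<not> adjacent G e c" "\<not> adjacent G e d"
    have nadj': "\<not> adjacent G c a" "\<not> adjacent G d b"
        "\<not> adjacent G b e" "\<not> adjacent G c e" "\<not> adjacent G d e"
      using nadj sym by blast+
    let ?g = "(!) [a, b, c, d, e]"
    have V: "verts Flag_compl = {0, 1, 2, 3, 4}" by (simp add: Flag_compl_def)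
    have "a \<noteq> b" "a \<noteq> d" "a \<noteq> e" "b \<noteq> c" "b \<noteq> e" "c \<noteq> d" "c \<noteq> e" "d \<noteq> e"
      using adj nadj in_verts sym by blast+
    then have "inj_on ?g (verts Flag_compl)" unfolding V using ne by (simp add: inj_on_def)
    moreover have "?g ` verts Flag_compl \<subseteq> verts G" unfolding V using adj in_verts by simp
    moreover have "adjacent G (?g i) (?g j) \<longleftrightarrow> adjacent Flag_compl i j"
      if "i \<in> verts Flag_compl" "j \<in> verts Flag_compl" for i j
      using that unfolding V
      by (elim insertE emptyE) (simp_all add: adj nadj adj[THEN sym] nadj' irrefl Flag_compl_edge)
    ultimately show False using family_free_no_embedding[OF free, of Flag_compl ?g] by blast
  qed
qed

theorem mainTheorem1:
  fixes G :: "'a ugraph"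
  assumes "finite_simple_graph G"
    and "family_free {P5, Flag_compl} G"
  shows "int (chromatic_number G) \<le>
    \<lceil>(real (max_degree G) + real (clique_number G) + 1) / 2\<rceil>"
proof -
  interpret P5_banner_free "adjacent G"
    using P5_banner_free_adjacent assms by blast
  have fin: "finite (verts G)" using assms(1) unfolding finite_simple_graph_def by blast
  have "clique K (edges G) \<longleftrightarrow> complete K" for K
    unfolding clique_def complete_def adjacent_def by blast
  then have "Delta (verts G) = max_degree G" "omega (verts G) = clique_number G"
    unfolding Delta_def max_degree_def deg_def[abs_def] degree_def[abs_def] omega_def clique_number_def
    by simp_all
  then have "colorable (verts G) ((max_degree G + clique_number G + 2) div 2)"
    using colorable_reed_bound[OF fin] unfolding reed_bound_def by simp
  then have "\<exists>c. proper_coloring G ((max_degree G + clique_number G + 2) div 2) c"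
    unfolding colorable_def proper_coloring_def .
  then have "chromatic_number G \<le> (max_degree G + clique_number G + 2) div 2"
    unfolding chromatic_number_def by (rule Least_le)
  then have "2 * real (chromatic_number G) \<le> real (max_degree G) + real (clique_number G) + 2"
    by linarith
  \<comment> \<open>An integer \<open>n\<close> is at most the ceiling of \<open>r\<close> exactly
    if \<open>n - 1 < r\<close>, which absorbs the step from \<open>+ 2\<close> to
    \<open>+ 1\<close>.\<close>
  then show ?thesis by (simp add: le_ceiling_iff)
qed

end
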